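(* Let $\mathcal X=\{x_1,\dots,x_n\}$ be a finite state space, let $\pi$ (target) and $p$ (proposal) be probability mass functions on $\mathcal X$ with $p(x_i)>0$ for all $i$, and let $w=\pi/p$. Assume the states are labelled so that $w^\star=w(x_1)\ge w(x_2)\ge\dots\ge w(x_n)$, where $w^\star=\max_i w(x_i)$, and, if $w^\star$ is attained at several states, $x_1$ is one of these having the smallest $\pi$-probability. Let $P$ be the transition kernel of the Independent Metropolis-Hastings (IMH) chain with target $\pi$ and proposal $p$. Then for every integer $t\ge1$, $$(1-\pi(x_1))\Big(1-\frac1{w^\star}\Big)^t\;\le\;\sup_{x\in\operatorname{supp}(\pi)}\|P^t(x,\cdot)-\pi\|_{\mathrm{TV}}\;\le\;\Big(1-\inf_{x_i\in\mathcal X}\pi(x_i)\Big)\Big(1-\frac1{w^\star}\Big)^t .$$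
   Context: $\operatorname{supp}(\pi)=\{x\in\mathcal X:\pi(x)>0\}$. The IMH chain, started in (and remaining in) $\operatorname{supp}(\pi)$, has transition probabilities, for $x_i\in\operatorname{supp}(\pi)$, $$P(x_i,x_j)=\begin{cases}p(x_j)\min\{1,\frac{w(x_j)}{w(x_i)}\}, & j\ne i,\\[2pt] p(x_i)+\sum_k p(x_k)\max\{0,1-\frac{w(x_k)}{w(x_i)}\}, & j=i.\end{cases}$$ $P^t$ is the $t$-step kernel, and $\|\mu-\nu\|_{\mathrm{TV}}=\max_{A\subset\mathcal X}|\mu(A)-\nu(A)|$. *)

theory Defs
  imports "HOL-Probability.Probability"
begin

definition weight :: "'a pmf \<Rightarrow> 'a pmf \<Rightarrow> 'a \<Rightarrow> real" where
  "weight \<pi> p x = pmf \<pi> x / pmf p x"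

definition imh_prob :: "'a::finite pmf \<Rightarrow> 'a pmf \<Rightarrow> 'a \<Rightarrow> 'a \<Rightarrow> real" where
  "imh_prob \<pi> p x y =
    (if y \<noteq> x then pmf p y * min 1 (weight \<pi> p y / weight \<pi> p x)
     else pmf p x + (\<Sum>z\<in>UNIV. pmf p z * max 0 (1 - weight \<pi> p z / weight \<pi> p x)))"

text \<open>
  The chain lives on the support of \<open>\<pi>\<close>. Outside of it the weight in the denominator
  is zero, the transition probabilities need not sum to one, and the value of the kernel below
  is unspecified. The lemmas below show that on the support the kernel has
  the intended mass function and never leaves the support.
\<close>

definition imh_kernel :: "'a::finite pmf \<Rightarrow> 'a pmf \<Rightarrow> 'a \<Rightarrow> 'a pmf" where
  "imh_kernel \<pi> p x = embed_pmf (imh_prob \<pi> p x)"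

primrec kernel_power :: "('a \<Rightarrow> 'a pmf) \<Rightarrow> nat \<Rightarrow> 'a \<Rightarrow> 'a pmf" where
  "kernel_power K 0 x = return_pmf x"
| "kernel_power K (Suc t) x = bind_pmf (kernel_power K t x) K"

definition tv_dist :: "'a::finite pmf \<Rightarrow> 'a pmf \<Rightarrow> real" where
  "tv_dist \<mu> \<nu> = (MAX A\<in>UNIV. \<bar>measure_pmf.prob \<mu> A - measure_pmf.prob \<nu> A\<bar>)"

lemma imh_prob_nonneg: "0 \<le> imh_prob \<pi> p x y"
  by (auto simp: imh_prob_def weight_def intro!: add_nonneg_nonneg sum_nonneg)

lemma imh_prob_sum:
  assumes "x \<in> set_pmf \<pi>" and "pmf p x > 0"
  shows "(\<Sum>y\<in>UNIV. imh_prob \<pi> p x y) = 1"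
proof -
  let ?r = "\<lambda>y. weight \<pi> p y / weight \<pi> p x"
  have "weight \<pi> p x \<noteq> 0"
    using assms by (simp add: weight_def set_pmf_iff)
  then have rx: "?r x = 1" by simp
  have "(\<Sum>y\<in>UNIV. imh_prob \<pi> p x y) = imh_prob \<pi> p x x + (\<Sum>y\<in>UNIV - {x}. imh_prob \<pi> p x y)"
    by (simp add: sum.remove)
  also have "(\<Sum>y\<in>UNIV - {x}. imh_prob \<pi> p x y) = (\<Sum>y\<in>UNIV - {x}. pmf p y * min 1 (?r y))"
    by (intro sum.cong) (auto simp: imh_prob_def)
  also have "imh_prob \<pi> p x x = pmf p x * min 1 (?r x) + (\<Sum>z\<in>UNIV. pmf p z * max 0 (1 - ?r z))"
    unfolding rx by (simp add: imh_prob_def)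
  also have "\<dots> + (\<Sum>y\<in>UNIV - {x}. pmf p y * min 1 (?r y)) =
      (\<Sum>y\<in>UNIV. pmf p y * min 1 (?r y)) + (\<Sum>z\<in>UNIV. pmf p z * max 0 (1 - ?r z))"
    by (simp add: sum.remove[where x = x and A = UNIV and g = "\<lambda>y. pmf p y * min 1 (?r y)"])
  also have "\<dots> = (\<Sum>y\<in>UNIV. pmf p y * (min 1 (?r y) + max 0 (1 - ?r y)))"
    by (simp add: sum.distrib distrib_left)
  also have "\<dots> = (\<Sum>y\<in>UNIV. pmf p y)"
    by (intro sum.cong) (auto simp: min_def max_def)
  also have "\<dots> = 1" by (rule sum_pmf_eq_1) auto
  finally show ?thesis .
qed

lemma pmf_imh_kernel:
  assumes "x \<in> set_pmf \<pi>" and "pmf p x > 0"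
  shows "pmf (imh_kernel \<pi> p x) y = imh_prob \<pi> p x y"
  unfolding imh_kernel_def
proof (rule pmf_embed_pmf)
  show "(\<integral>\<^sup>+ y. ennreal (imh_prob \<pi> p x y) \<partial>count_space UNIV) = 1"
    using imh_prob_sum[OF assms]
    by (simp add: nn_integral_count_space_finite imh_prob_nonneg sum_ennreal)
qed (rule imh_prob_nonneg)

lemma set_pmf_imh_kernel:
  assumes "x \<in> set_pmf \<pi>" and "pmf p x > 0"
  shows "set_pmf (imh_kernel \<pi> p x) \<subseteq> set_pmf \<pi>"
proof
  fix y assume "y \<in> set_pmf (imh_kernel \<pi> p x)"
  then show "y \<in> set_pmf \<pi>"
    using assms by (cases "y = x") (auto simp: set_pmf_iff pmf_imh_kernel imh_prob_def weight_def)
qed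

end

theory Submission imports Defs begin

text \<open>
  Put \<open>\<epsilon> = 1 / w_star\<close>. The kernel satisfies \<open>P(y, \<cdot>) \<ge> \<epsilon> \<pi>\<close> and leaves \<open>\<pi>\<close> invariant, so
  \<open>P\<^sup>t(y, \<cdot>) \<ge> (1 - (1 - \<epsilon>)\<^sup>t) \<pi>\<close>. For nonempty \<open>A\<close>, applying this to the complement of \<open>A\<close> gives
  \<open>P\<^sup>t(y, A) - \<pi>(A) \<le> (1 - \<epsilon>)\<^sup>t (1 - \<pi>(A))\<close>, and \<open>\<pi>(A)\<close> is at least the smallest mass of a point.
  From the state of maximal weight the minorisation is an equality off the diagonal:
  \<open>P(x\<^sub>1, \<cdot>) = \<epsilon> \<pi> + (1 - \<epsilon>) \<delta>\<close> with \<open>\<delta>\<close> the point mass at \<open>x\<^sub>1\<close>, hence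
  \<open>P\<^sup>t(x\<^sub>1, \<cdot>) - \<pi> = (1 - \<epsilon>)\<^sup>t (\<delta> - \<pi>)\<close>, and testing on \<open>{x\<^sub>1}\<close> gives the lower bound.
\<close>

section \<open>Powers of a general kernel with an invariant law\<close>

lemma pmf_bind_finite:
  fixes N :: "'a::finite pmf"
  shows "pmf (bind_pmf N K) z = (\<Sum>y\<in>UNIV. pmf N y * pmf (K y) z)"
  by (simp add: pmf_bind integral_measure_pmf_real[where A = UNIV] mult.commute)

lemma set_pmf_kernel_power:
  assumes "\<And>y. y \<in> S \<Longrightarrow> set_pmf (K y) \<subseteq> S" and "y \<in> S"
  shows "set_pmf (kernel_power K t y) \<subseteq> S"
  using assms by (induction t) fastforce+

text \<open>Split the \<open>t\<close>-step law into \<open>a * \<pi>\<close> plus a nonnegative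
  residual \<open>r\<close> of mass \<open>1 - a\<close>. In one more step invariance reproduces
  \<open>a * \<pi>\<close>, while the residual contributes at least
  \<open>(1 - a) * \<epsilon> * \<pi>\<close>; and
  \<open>a + (1 - a) * \<epsilon> = 1 - (1 - \<epsilon>) ^ Suc t\<close>.\<close>

lemma kernel_power_minorization:
  fixes \<pi> :: "'a::finite pmf"
  assumes inv: "bind_pmf \<pi> K = \<pi>"
    and closed: "\<And>y. y \<in> set_pmf \<pi> \<Longrightarrow> set_pmf (K y) \<subseteq> set_pmf \<pi>"
    and minor: "\<And>y z. y \<in> set_pmf \<pi> \<Longrightarrow> \<epsilon> * pmf \<pi> z \<le> pmf (K y) z"
    and y: "y \<in> set_pmf \<pi>"
  shows "(1 - (1 - \<epsilon>) ^ t) * pmf \<pi> z \<le> pmf (kernel_power K t y) z"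
proof (induction t arbitrary: z)
  case (Suc t)
  define a where "a = 1 - (1 - \<epsilon>) ^ t"
  define r where "r u = pmf (kernel_power K t y) u - a * pmf \<pi> u" for u
  have r_nonneg: "0 \<le> r u" for u
    using Suc.IH[of u] by (simp add: r_def a_def)
  have closed_power: "set_pmf (kernel_power K t y) \<subseteq> set_pmf \<pi>"
    using closed y by (rule set_pmf_kernel_power)
  \<comment> \<open>\<open>minor\<close> holds only on the support of \<open>\<pi>\<close>;
    elsewhere the residual carries no mass.\<close>
  have supp: "r u = 0" if "u \<notin> set_pmf \<pi>" for u
    using that closed_power by (auto simp: r_def set_pmf_iff)
  have "(\<Sum>u\<in>UNIV. r u) = (\<Sum>u\<in>UNIV. pmf (kernel_power K t y) u) - a * (\<Sum>u\<in>UNIV. pmf \<pi> u)"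
    by (simp add: r_def sum_subtractf sum_distrib_left)
  also have "\<dots> = 1 - a"
    by (simp add: sum_pmf_eq_1)
  finally have r_sum: "(\<Sum>u\<in>UNIV. r u) = 1 - a" .
  have "(1 - (1 - \<epsilon>) ^ Suc t) * pmf \<pi> z = a * pmf \<pi> z + (\<Sum>u\<in>UNIV. r u) * (\<epsilon> * pmf \<pi> z)"
    unfolding r_sum a_def by (simp add: algebra_simps)
  also have "(\<Sum>u\<in>UNIV. r u) * (\<epsilon> * pmf \<pi> z) = (\<Sum>u\<in>UNIV. r u * (\<epsilon> * pmf \<pi> z))"
    by (rule sum_distrib_right)
  also have "\<dots> \<le> (\<Sum>u\<in>UNIV. r u * pmf (K u) z)"
  proof (rule sum_mono)
    fix u
    show "r u * (\<epsilon> * pmf \<pi> z) \<le> r u * pmf (K u) z"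
      using minor[of u z] r_nonneg[of u] supp[of u]
      by (cases "u \<in> set_pmf \<pi>") (auto intro: mult_left_mono)
  qed
  also have "a * pmf \<pi> z = a * (\<Sum>u\<in>UNIV. pmf \<pi> u * pmf (K u) z)"
    using pmf_bind_finite[of \<pi> K z] by (simp add: inv)
  also have "\<dots> + (\<Sum>u\<in>UNIV. r u * pmf (K u) z) = pmf (kernel_power K (Suc t) y) z"
    by (simp add: pmf_bind_finite r_def sum_distrib_left algebra_simps flip: sum.distrib)
  finally show ?case by simp
qed simp

text \<open>For \<open>\<epsilon>\<close> in [0, 1], read each step from \<open>y\<close> as a jump
  into \<open>\<pi>\<close> with probability \<open>\<epsilon>\<close>, and otherwise a stay at
  \<open>y\<close>. After a jump the law remains \<open>\<pi>\<close> by invariance, so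
  \<open>(1 - \<epsilon>) ^ t\<close> is the probability of no jump so far.\<close>

lemma kernel_power_lazy_jump:
  fixes \<pi> :: "'a::finite pmf"
  assumes inv: "bind_pmf \<pi> K = \<pi>"
    and jump: "\<And>z. pmf (K y) z = \<epsilon> * pmf \<pi> z + (1 - \<epsilon>) * indicator {y} z"
  shows "pmf (kernel_power K t y) z = (1 - (1 - \<epsilon>) ^ t) * pmf \<pi> z + (1 - \<epsilon>) ^ t * indicator {y} z"
proof (induction t arbitrary: z)
  case (Suc t)
  let ?b = "(1 - \<epsilon>) ^ t"
  have "pmf (kernel_power K (Suc t) y) z
      = (\<Sum>u\<in>UNIV. ((1 - ?b) * pmf \<pi> u + ?b * indicator {y} u) * pmf (K u) z)"
    by (simp add: pmf_bind_finite Suc.IH)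
  also have "\<dots> = (1 - ?b) * (\<Sum>u\<in>UNIV. pmf \<pi> u * pmf (K u) z)
      + ?b * (\<Sum>u\<in>UNIV. indicator {y} u * pmf (K u) z)"
    by (simp add: distrib_right mult.assoc sum.distrib flip: sum_distrib_left)
  also have "(\<Sum>u\<in>UNIV. pmf \<pi> u * pmf (K u) z) = pmf \<pi> z"
    using pmf_bind_finite[of \<pi> K z] by (simp add: inv)
  also have "(\<Sum>u\<in>UNIV. indicator {y} u * pmf (K u) z) = pmf (K y) z"
    by (simp add: indicator_def if_distrib[of "\<lambda>c. c * _"] cong: if_cong)
  finally show ?case
    by (simp add: jump algebra_simps)
qed (simp add: indicator_def)

section \<open>Bounds on total variation distance\<close>

lemma abs_measure_diff_le_tv_dist:
  "\<bar>measure_pmf.prob \<mu> A - measure_pmf.prob \<nu> A\<bar> \<le> tv_dist \<mu> \<nu>"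
  unfolding tv_dist_def by (rule Max_ge) auto

lemma tv_dist_le_of_minorization:
  fixes \<mu> \<pi> :: "'a::finite pmf"
  assumes minor: "\<And>z. (1 - b) * pmf \<pi> z \<le> pmf \<mu> z"
    and b: "0 \<le> b"
    and m: "\<And>z. m \<le> pmf \<pi> z"
  shows "tv_dist \<mu> \<pi> \<le> (1 - m) * b"
proof -
  have compl: "measure_pmf.prob \<nu> (- A) = 1 - measure_pmf.prob \<nu> A" for \<nu> :: "'a pmf" and A
    using measure_pmf.prob_compl[of A \<nu>] by (simp add: Compl_eq_Diff_UNIV)
  have m_le_1: "m \<le> 1"
    by (rule order_trans[OF m pmf_le_1])
  have one_sided: "measure_pmf.prob \<mu> A - measure_pmf.prob \<pi> A \<le> (1 - m) * b" for A
  proof (cases "A = {}")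
    case True
    then show ?thesis using b m_le_1 by simp
  next
    case False
    then obtain z where "z \<in> A" by blast
    then have "m \<le> measure_pmf.prob \<pi> A"
      using m[of z] measure_pmf.finite_measure_mono[of "{z}" A \<pi>] by (simp add: measure_pmf_single)
    then have "(1 - measure_pmf.prob \<pi> A) * b \<le> (1 - m) * b"
      using b by (intro mult_right_mono) auto
    moreover have "(1 - b) * measure_pmf.prob \<pi> (- A) \<le> measure_pmf.prob \<mu> (- A)"
      by (simp add: measure_measure_pmf_finite sum_distrib_left sum_mono minor)
    ultimately show ?thesis
      by (simp add: compl algebra_simps)
  qed
  \<comment> \<open>Passing to the complement flips the sign of the difference, so the one-sided
    bound covers both signs.\<close>
  have "\<bar>measure_pmf.prob \<mu> A - measure_pmf.prob \<pi> A\<bar> \<le> (1 - m) * b" for A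
    using one_sided[of A] one_sided[of "- A"] by (simp add: compl)
  then show ?thesis
    unfolding tv_dist_def by (intro Max.boundedI) auto
qed

section \<open>The IMH kernel under a positive proposal\<close>

context
  fixes \<pi> p :: "'a::finite pmf"
  assumes p_pos: "\<And>y. pmf p y > 0"
begin

lemma weight_pos: "y \<in> set_pmf \<pi> \<Longrightarrow> weight \<pi> p y > 0"
  using p_pos[of y] by (simp add: weight_def pmf_positive)

lemma pmf_times_weight: "pmf p y * weight \<pi> p y = pmf \<pi> y"
  using p_pos[of y] by (simp add: weight_def)

text \<open>Moving \<open>pmf p z\<close> inside the minimum cancels the weight of \<open>z\<close>.
  Reversibility and both comparisons with \<open>\<pi>\<close> start from this form.\<close>

lemma imh_kernel_off_diagonal:
  assumes "y \<in> set_pmf \<pi>" and "z \<noteq> y"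
  shows "pmf (imh_kernel \<pi> p y) z = min (pmf p z) (pmf \<pi> z / weight \<pi> p y)"
  using assms p_pos[of z]
  by (simp add: pmf_imh_kernel p_pos imh_prob_def min_mult_distrib_left pmf_times_weight)

text \<open>Off the diagonal both sides equal
  \<open>min (pmf \<pi> y * pmf p z) (pmf p y * pmf \<pi> z)\<close>, which is symmetric in
  \<open>y\<close> and \<open>z\<close>.\<close>

lemma imh_detailed_balance:
  assumes "y \<in> set_pmf \<pi>" and "z \<in> set_pmf \<pi>"
  shows "pmf \<pi> y * pmf (imh_kernel \<pi> p y) z = pmf \<pi> z * pmf (imh_kernel \<pi> p z) y"
proof (cases "z = y")
  case False
  have "pmf \<pi> u * (pmf \<pi> v / weight \<pi> p u) = pmf p u * pmf \<pi> v"
    if "u \<in> set_pmf \<pi>" for u v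
    using weight_pos[OF that] by (simp flip: pmf_times_weight[of u])
  then have "pmf \<pi> u * min (pmf p v) (pmf \<pi> v / weight \<pi> p u) = min (pmf \<pi> u * pmf p v) (pmf p u * pmf \<pi> v)"
    if "u \<in> set_pmf \<pi>" for u v
    using that by (simp add: min_mult_distrib_left del: times_divide_eq_right)
  then show ?thesis
    using assms False by (simp add: imh_kernel_off_diagonal min.commute mult.commute)
qed simp

lemma imh_stationary: "bind_pmf \<pi> (imh_kernel \<pi> p) = \<pi>"
proof (rule pmf_eqI)
  fix z
  let ?K = "imh_kernel \<pi> p"
  \<comment> \<open>If \<open>y\<close> or \<open>z\<close> lies outside the support, both sides
    vanish: either the factor from \<open>\<pi>\<close> is zero, or the kernel would have to leave
    the support.\<close>
  have "pmf \<pi> y * pmf (?K y) z = pmf \<pi> z * pmf (?K z) y" for y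
  proof (cases "y \<in> set_pmf \<pi> \<and> z \<in> set_pmf \<pi>")
    case False
    then show ?thesis
      using set_pmf_imh_kernel[of y \<pi> p] set_pmf_imh_kernel[of z \<pi> p] p_pos
      by (fastforce simp: set_pmf_iff)
  qed (simp add: imh_detailed_balance)
  then have "pmf (bind_pmf \<pi> ?K) z = pmf \<pi> z * (\<Sum>y\<in>UNIV. pmf (?K z) y)"
    by (simp add: pmf_bind_finite sum_distrib_left)
  then show "pmf (bind_pmf \<pi> ?K) z = pmf \<pi> z"
    by (simp add: sum_pmf_eq_1)
qed

text \<open>Both arguments of the off-diagonal minimum are at least \<open>pmf \<pi> z / W\<close>.
  On the diagonal the proposal mass \<open>pmf p y\<close> alone suffices.\<close>

lemma imh_minorization:
  assumes y: "y \<in> set_pmf \<pi>"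
    and W: "\<And>z. weight \<pi> p z \<le> W"
  shows "1 / W * pmf \<pi> z \<le> pmf (imh_kernel \<pi> p y) z"
proof -
  have wy: "weight \<pi> p y > 0" using y by (rule weight_pos)
  then have "W > 0" using W[of y] by simp
  have p_ge: "pmf \<pi> z / W \<le> pmf p z" for z
    using mult_left_mono[OF W[of z], of "pmf p z"] \<open>W > 0\<close>
    by (simp add: pmf_times_weight divide_le_eq)
  show ?thesis
  proof (cases "z = y")
    case True
    have "pmf p y \<le> pmf (imh_kernel \<pi> p y) y"
      using y by (simp add: pmf_imh_kernel p_pos imh_prob_def sum_nonneg)
    then show ?thesis using True p_ge[of y] by simp
  next
    case False
    then show ?thesis
      using y wy W[of y] p_ge[of z] by (simp add: imh_kernel_off_diagonal frac_le)
  qed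
qed

text \<open>At maximal weight the minimum is always its second argument. The diagonal entry then
  follows from total mass one, without evaluating the rejection sum.\<close>

lemma imh_kernel_max_weight:
  assumes y: "y \<in> set_pmf \<pi>"
    and W: "\<And>z. weight \<pi> p z \<le> weight \<pi> p y"
  shows "pmf (imh_kernel \<pi> p y) z
    = 1 / weight \<pi> p y * pmf \<pi> z + (1 - 1 / weight \<pi> p y) * indicator {y} z"
proof -
  let ?q = "\<lambda>z. pmf (imh_kernel \<pi> p y) z" and ?e = "1 / weight \<pi> p y"
  have off: "?q z = ?e * pmf \<pi> z" if "z \<noteq> y" for z
  proof -
    have "pmf \<pi> z / weight \<pi> p y \<le> pmf p z"
      using mult_left_mono[OF W[of z], of "pmf p z"] weight_pos[OF y]
      by (simp add: pmf_times_weight divide_le_eq)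
    then show ?thesis
      using y that by (simp add: imh_kernel_off_diagonal min_absorb2)
  qed
  have total: "pmf N y + (\<Sum>z\<in>UNIV - {y}. pmf N z) = 1" for N :: "'a pmf"
    using sum.remove[of UNIV y "pmf N"] sum_pmf_eq_1[of UNIV N] by simp
  have "(\<Sum>z\<in>UNIV - {y}. ?q z) = ?e * (\<Sum>z\<in>UNIV - {y}. pmf \<pi> z)"
    by (simp add: off sum_distrib_left)
  also have "(\<Sum>z\<in>UNIV - {y}. pmf \<pi> z) = 1 - pmf \<pi> y"
    using total[of \<pi>] by simp
  finally have "?q y = ?e * pmf \<pi> y + (1 - ?e)"
    using total[of "imh_kernel \<pi> p y"] by (simp add: diff_divide_distrib)
  then show ?thesis
    using off by (cases "z = y") auto
qed

text \<open>The mean of the weight under \<open>p\<close> is the total mass of \<open>\<pi>\<close>,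
  namely 1.\<close>

lemma one_le_weight_bound:
  assumes W: "\<And>z. weight \<pi> p z \<le> W"
  shows "1 \<le> W"
proof -
  have "1 = (\<Sum>z\<in>UNIV. pmf p z * weight \<pi> p z)"
    by (simp add: pmf_times_weight sum_pmf_eq_1)
  also have "\<dots> \<le> (\<Sum>z\<in>UNIV. pmf p z * W)"
    by (intro sum_mono mult_left_mono W) simp
  also have "\<dots> = W"
    by (simp add: sum_pmf_eq_1 flip: sum_distrib_right)
  finally show ?thesis .
qed

lemma imh_tv_dist_le:
  assumes "y \<in> set_pmf \<pi>"
    and W: "\<And>z. weight \<pi> p z \<le> W"
    and "\<And>z. m \<le> pmf \<pi> z"
  shows "tv_dist (kernel_power (imh_kernel \<pi> p) t y) \<pi> \<le> (1 - m) * (1 - 1 / W) ^ t"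
proof (rule tv_dist_le_of_minorization)
  show "(1 - (1 - 1 / W) ^ t) * pmf \<pi> z \<le> pmf (kernel_power (imh_kernel \<pi> p) t y) z" for z
    by (rule kernel_power_minorization[OF imh_stationary set_pmf_imh_kernel[OF _ p_pos]
          imh_minorization[OF _ W] assms(1)])
  show "0 \<le> (1 - 1 / W) ^ t"
    using one_le_weight_bound[OF W] by simp
qed fact

lemma imh_tv_dist_ge:
  assumes y: "y \<in> set_pmf \<pi>"
    and W: "\<And>z. weight \<pi> p z \<le> weight \<pi> p y"
  shows "(1 - pmf \<pi> y) * (1 - 1 / weight \<pi> p y) ^ t
    \<le> tv_dist (kernel_power (imh_kernel \<pi> p) t y) \<pi>"
proof -
  let ?\<mu> = "kernel_power (imh_kernel \<pi> p) t y"
  have "(1 - pmf \<pi> y) * (1 - 1 / weight \<pi> p y) ^ t = pmf ?\<mu> y - pmf \<pi> y"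
    unfolding kernel_power_lazy_jump[OF imh_stationary imh_kernel_max_weight[OF y W]]
    by (simp add: algebra_simps)
  also have "\<dots> \<le> tv_dist ?\<mu> \<pi>"
    using abs_measure_diff_le_tv_dist[of ?\<mu> "{y}" \<pi>] by (simp add: measure_pmf_single)
  finally show ?thesis .
qed

end

theorem theorem5:
  fixes \<pi> p :: "'a::finite pmf" and x :: "nat \<Rightarrow> 'a" and n t :: nat and w_star :: real
  assumes "bij_betw x {1..n} (UNIV :: 'a set)"
    and "\<And>i. i \<in> {1..n} \<Longrightarrow> pmf p (x i) > 0"
    and "w_star = (MAX i\<in>{1..n}. weight \<pi> p (x i))"
    and "w_star = weight \<pi> p (x 1)"
    and "\<And>i j. 1 \<le> i \<Longrightarrow> i \<le> j \<Longrightarrow> j \<le> n \<Longrightarrow> weight \<pi> p (x j) \<le> weight \<pi> p (x i)"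
    and "\<And>i. i \<in> {1..n} \<Longrightarrow> weight \<pi> p (x i) = w_star \<Longrightarrow> pmf \<pi> (x 1) \<le> pmf \<pi> (x i)"
    and "t \<ge> 1"
  shows "(1 - pmf \<pi> (x 1)) * (1 - 1 / w_star) ^ t
           \<le> (SUP y\<in>set_pmf \<pi>. tv_dist (kernel_power (imh_kernel \<pi> p) t y) \<pi>)
       \<and> (SUP y\<in>set_pmf \<pi>. tv_dist (kernel_power (imh_kernel \<pi> p) t y) \<pi>)
           \<le> (1 - (INF i\<in>{1..n}. pmf \<pi> (x i))) * (1 - 1 / w_star) ^ t"
proof -
  let ?d = "\<lambda>y. tv_dist (kernel_power (imh_kernel \<pi> p) t y) \<pi>"
  have range_x: "x ` {1..n} = UNIV"
    using assms(1) by (simp add: bij_betw_def)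
  have index: "\<exists>i\<in>{1..n}. y = x i" for y
    using range_x by blast
  have p_pos: "pmf p y > 0" for y
    using index[of y] assms(2) by auto
  have W: "weight \<pi> p y \<le> weight \<pi> p (x 1)" for y
    using index[of y] assms(5)[of 1] by auto
  have m: "(INF i\<in>{1..n}. pmf \<pi> (x i)) \<le> pmf \<pi> y" for y
    using index[of y] by (auto intro!: cINF_lower)
  \<comment> \<open>The maximal weight is at least 1, so \<open>x 1\<close> is an admissible
    starting state for the lower bound.\<close>
  have "weight \<pi> p (x 1) \<noteq> 0"
    using one_le_weight_bound[OF p_pos W] by linarith
  then have x1: "x 1 \<in> set_pmf \<pi>"
    by (auto simp: weight_def set_pmf_iff)
  have "?d (x 1) \<le> (SUP y\<in>set_pmf \<pi>. ?d y)"
    using x1 by (intro cSUP_upper) auto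
  moreover have "(SUP y\<in>set_pmf \<pi>. ?d y)
      \<le> (1 - (INF i\<in>{1..n}. pmf \<pi> (x i))) * (1 - 1 / w_star) ^ t"
    unfolding assms(4)
    by (intro cSUP_least set_pmf_not_empty imh_tv_dist_le[OF p_pos _ W m])
  ultimately show ?thesis
    using imh_tv_dist_ge[OF p_pos x1 W, of t] unfolding assms(4) by linarith
qed

end
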